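(* Let $\mathcal{H}_1,\mathcal{H}_2$ be real or complex Hilbert spaces, $M=\mathcal{H}_1\oplus\{0\}$, $N=\mathcal{H}_2\oplus\{0\}$, and let $A,B\in\mathcal{B}(\mathcal{H}_1,\mathcal{H}_2)$ be such that $T=\begin{pmatrix} A & A \\ A & A+B \end{pmatrix}\in\mathcal{B}(\mathcal{H}_1\oplus\mathcal{H}_1,\mathcal{H}_2\oplus\mathcal{H}_2)$ is $(M,N)$-complementable and $A^*(2A+B)=0$. (i) If $X_1$ is the Douglas reduced solution of the equation $A:B=AX_1$, then $\|X_1\|\ge\sqrt2$. In particular, if $\mathcal{R}(A)$ is closed, then $\|A^\dagger(A:B)\|\ge\sqrt2$. (ii) If $X_2$ is the Douglas reduced solution of the equation $A=(A+B)X_2$, then $\|X_2\|\ge\sqrt2-1$. In particular, if $\mathcal{R}(A+B)$ is closed, then $\|(A+B)^\dagger A\|\ge\sqrt2-1$.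
   Context: $\mathcal{R}(\cdot)$, $\mathcal{N}(\cdot)$ denote range and null space; $S^\dagger$ is the Moore–Penrose inverse of a closed-range bounded operator $S$. $T$ is $(M,N)$-complementable precisely when $\mathcal{R}(A)\subseteq\mathcal{R}(A+B)$ and $\mathcal{R}(A^* )\subseteq\mathcal{R}(A^*+B^* )$, i.e. $A$ and $B$ are parallel summable. If $\mathcal{R}(A_1)\subseteq\mathcal{R}(B_1)$ for bounded operators $A_1,B_1$ with the same codomain, the Douglas reduced solution of $A_1=B_1X$ is the unique bounded $C_1$ with $A_1=B_1C_1$ and $\mathcal{R}(C_1)\subseteq\mathcal{N}(B_1)^\perp$. The parallel sum is $A:B=A-AZ=A-YA\in\mathcal{B}(\mathcal{H}_1,\mathcal{H}_2)$, where $Z$ is the Douglas reduced solution of $A=(A+B)X$ and $Y^*$ is the Douglas reduced solution of $A^*=(A+B)^*X$.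
   Formalization: The formal theorem additionally assumes A ≠ 0; for A = 0 the statement is false, since then A:B = 0 and the Douglas reduced solutions X_1 and X_2 are both zero (for example A = 0, B = 1 on the real line). *)

theory Defs
  imports "HOL-Analysis.Analysis"
begin

text \<open>
  By the Gelfand--Mazur theorem the instances of the following class are exactly the real and
  the complex numbers; it serves to state results for real and complex Hilbert spaces at once.
\<close>

class real_or_complex = real_normed_field +
  fixes conj :: "'a \<Rightarrow> 'a"
  assumes conj_add: "conj (x + y) = conj x + conj y"
    and conj_mult: "conj (x * y) = conj x * conj y"
    and mult_conj_self: "x * conj x = (norm x)\<^sup>2 *\<^sub>R 1"

instantiation real :: real_or_complex
begin
definition conj_real :: "real \<Rightarrow> real" where "conj_real x = x"
instance by standard (simp_all add: conj_real_def power2_eq_square)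
end

instantiation complex :: real_or_complex
begin
definition conj_complex :: "complex \<Rightarrow> complex" where "conj_complex x = cnj x"
instance by standard (simp_all add: conj_complex_def scaleR_conv_of_real complex_norm_square del: of_real_power)
end

text \<open>
  A Hilbert space over \<open>'k\<close>: the underlying type supplies the real vector space structure, the
  norm and completeness; the scalar multiplication and the inner product (linear in the first
  argument) are parameters compatible with them.
\<close>

locale hilbert_space = vector_space scale
  for scale :: "'k::real_or_complex \<Rightarrow> 'a::banach \<Rightarrow> 'a" +
  fixes ip :: "'a \<Rightarrow> 'a \<Rightarrow> 'k"
  assumes scale_of_real: "scale (of_real r) x = r *\<^sub>R x"
    and ip_add_left: "ip (x + y) z = ip x z + ip y z"
    and ip_scale_left: "ip (scale c x) y = c * ip x y"
    and ip_conj: "ip y x = conj (ip x y)"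
    and ip_self: "ip x x = of_real ((norm x)\<^sup>2)"

lemma hilbert_space_real:
  "hilbert_space scaleR (inner :: 'a::{real_inner,banach} \<Rightarrow> 'a \<Rightarrow> real)"
  by unfold_locales
    (simp_all add: algebra_simps conj_real_def inner_commute power2_norm_eq_inner)

lemma hilbert_space_complex: "hilbert_space (*) (\<lambda>x y. x * cnj y)"
  by unfold_locales
    (simp_all add: algebra_simps conj_complex_def scaleR_conv_of_real complex_norm_square
      del: of_real_power)

text \<open>The direct sum of two Hilbert spaces; it carries the library's Euclidean product norm.\<close>

definition prod_scale :: "('k \<Rightarrow> 'a \<Rightarrow> 'a) \<Rightarrow> ('k \<Rightarrow> 'b \<Rightarrow> 'b) \<Rightarrow> 'k \<Rightarrow> 'a \<times> 'b \<Rightarrow> 'a \<times> 'b"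
  where "prod_scale s t c v = (s c (fst v), t c (snd v))"

definition prod_ip ::
  "('a \<Rightarrow> 'a \<Rightarrow> 'k::plus) \<Rightarrow> ('b \<Rightarrow> 'b \<Rightarrow> 'k) \<Rightarrow> 'a \<times> 'b \<Rightarrow> 'a \<times> 'b \<Rightarrow> 'k"
  where "prod_ip g h v w = g (fst v) (fst w) + h (snd v) (snd w)"

lemma hilbert_space_prod:
  assumes "hilbert_space s g" "hilbert_space t h"
  shows "hilbert_space (prod_scale s t) (prod_ip g h)"
proof -
  interpret H: hilbert_space s g by fact
  interpret K: hilbert_space t h by fact
  show ?thesis
  proof unfold_locales
    show "prod_ip g h y x = conj (prod_ip g h x y)" for x y
      by (metis prod_ip_def conj_add H.ip_conj K.ip_conj)
    show "prod_ip g h x x = of_real ((norm x)\<^sup>2)" for x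
      by (simp add: prod_ip_def H.ip_self K.ip_self norm_prod_def)
  qed (auto simp: prod_scale_def prod_ip_def algebra_simps prod_eq_iff
        H.scale_of_real K.scale_of_real H.ip_add_left K.ip_add_left
        H.ip_scale_left K.ip_scale_left H.scale_right_distrib K.scale_right_distrib
        H.scale_left_distrib K.scale_left_distrib)
qed

definition bounded_op ::
  "('k::real_or_complex \<Rightarrow> 'a::banach \<Rightarrow> 'a) \<Rightarrow> ('k \<Rightarrow> 'b::banach \<Rightarrow> 'b) \<Rightarrow> ('a \<Rightarrow> 'b) \<Rightarrow> bool"
  where "bounded_op s t A \<longleftrightarrow> Vector_Spaces.linear s t A \<and> bounded_linear A"

definition null_space :: "('a \<Rightarrow> 'b::zero) \<Rightarrow> 'a set"
  where "null_space A = {x. A x = 0}"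

definition orth :: "('a \<Rightarrow> 'a \<Rightarrow> 'k::zero) \<Rightarrow> 'a set \<Rightarrow> 'a set"
  where "orth g S = {x. \<forall>y\<in>S. g x y = 0}"

definition orth_proj :: "('a::minus \<Rightarrow> 'a \<Rightarrow> 'k::zero) \<Rightarrow> 'a set \<Rightarrow> 'a \<Rightarrow> 'a"
  where "orth_proj g M x = (THE m. m \<in> M \<and> x - m \<in> orth g M)"

definition adj :: "('a \<Rightarrow> 'a \<Rightarrow> 'k) \<Rightarrow> ('b \<Rightarrow> 'b \<Rightarrow> 'k) \<Rightarrow> ('a \<Rightarrow> 'b) \<Rightarrow> 'b \<Rightarrow> 'a"
  where "adj g h A = (THE A'. \<forall>x y. h (A x) y = g x (A' y))"

text \<open>\<open>C\<close> is the Douglas reduced solution of the equation \<open>A = B X\<close>.\<close>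

definition reduced_solution ::
  "('k::real_or_complex \<Rightarrow> 'a::banach \<Rightarrow> 'a) \<Rightarrow>
   ('k \<Rightarrow> 'c::banach \<Rightarrow> 'c) \<Rightarrow> ('c \<Rightarrow> 'c \<Rightarrow> 'k) \<Rightarrow> ('a \<Rightarrow> 'b::zero) \<Rightarrow> ('c \<Rightarrow> 'b) \<Rightarrow> ('a \<Rightarrow> 'c) \<Rightarrow> bool"
  where "reduced_solution s t g A B C \<longleftrightarrow>
    bounded_op s t C \<and> A = B \<circ> C \<and> range C \<subseteq> orth g (null_space B)"

text \<open>The parallel sum \<open>A : B = A - A Z\<close>.\<close>

definition parallel_sum ::
  "('k::real_or_complex \<Rightarrow> 'a::banach \<Rightarrow> 'a) \<Rightarrow> ('a \<Rightarrow> 'a \<Rightarrow> 'k) \<Rightarrow>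
   ('a \<Rightarrow> 'b::banach) \<Rightarrow> ('a \<Rightarrow> 'b) \<Rightarrow> 'a \<Rightarrow> 'b"
  where "parallel_sum s g A B =
    (let Z = THE Z. reduced_solution s s g A (\<lambda>x. A x + B x) Z in (\<lambda>x. A x - A (Z x)))"

text \<open>The Moore--Penrose inverse, characterised by the four Penrose equations.\<close>

definition mp_inverse ::
  "('k::real_or_complex \<Rightarrow> 'a::banach \<Rightarrow> 'a) \<Rightarrow> ('a \<Rightarrow> 'a \<Rightarrow> 'k) \<Rightarrow>
   ('k \<Rightarrow> 'b::banach \<Rightarrow> 'b) \<Rightarrow> ('b \<Rightarrow> 'b \<Rightarrow> 'k) \<Rightarrow> ('a \<Rightarrow> 'b) \<Rightarrow> 'b \<Rightarrow> 'a"
  where "mp_inverse s g t h A = (THE X. bounded_op t s X \<and>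
    A \<circ> X \<circ> A = A \<and> X \<circ> A \<circ> X = X \<and>
    adj h h (A \<circ> X) = A \<circ> X \<and> adj g g (X \<circ> A) = X \<circ> A)"

text \<open>The operator with block matrix \<open>(A B; C D)\<close>.\<close>

definition block_op ::
  "('a \<Rightarrow> 'c::plus) \<Rightarrow> ('b \<Rightarrow> 'c) \<Rightarrow> ('a \<Rightarrow> 'd::plus) \<Rightarrow> ('b \<Rightarrow> 'd) \<Rightarrow> 'a \<times> 'b \<Rightarrow> 'c \<times> 'd"
  where "block_op A B C D v = (A (fst v) + B (snd v), C (fst v) + D (snd v))"

text \<open>
  For closed subspaces \<open>M\<close> and \<open>N\<close> of the domain and codomain of \<open>T\<close>, write \<open>T\<close> as a block matrix
  with respect to the decompositions \<open>M \<oplus> M\<^sup>\<bottom>\<close> and \<open>N \<oplus> N\<^sup>\<bottom>\<close>. Complementability means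
  \<open>\<R>(T\<^sub>2\<^sub>1) \<subseteq> \<R>(T\<^sub>2\<^sub>2)\<close> and \<open>\<R>(T\<^sub>1\<^sub>2\<^sup>*) \<subseteq> \<R>(T\<^sub>2\<^sub>2\<^sup>*)\<close>. For the block matrix
  \<open>(A A; A A+B)\<close> and the first summands these are \<open>\<R>(A) \<subseteq> \<R>(A+B)\<close> and
  \<open>\<R>(A\<^sup>*) \<subseteq> \<R>(A\<^sup>*+B\<^sup>*)\<close>.
\<close>

definition complementable ::
  "('a::ab_group_add \<Rightarrow> 'a \<Rightarrow> 'k::zero) \<Rightarrow> ('b::ab_group_add \<Rightarrow> 'b \<Rightarrow> 'k) \<Rightarrow>
   'a set \<Rightarrow> 'b set \<Rightarrow> ('a \<Rightarrow> 'b) \<Rightarrow> bool"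
  where "complementable g h M N T \<longleftrightarrow>
    (let P = orth_proj g M; P' = (\<lambda>x. x - P x); Q = orth_proj h N; Q' = (\<lambda>y. y - Q y); T' = adj g h T
     in range (Q' \<circ> T \<circ> P) \<subseteq> range (Q' \<circ> T \<circ> P') \<and> range (P' \<circ> T' \<circ> Q) \<subseteq> range (P' \<circ> T' \<circ> Q'))"

end

theory Submission
  imports Defs
begin

text \<open>
  Write \<open>S = A + B\<close>. The hypothesis \<open>A\<^sup>*(2A + B) = 0\<close> says that \<open>\<R>(A)\<close> is orthogonal to the
  range of \<open>2A + B = A + S\<close>. If \<open>S z = A x\<close>, then \<open>(A + S) z = A (z + x)\<close> lies in both of these
  ranges, so it is zero and \<open>A z = - A x\<close>. Hence every bounded \<open>Z\<close> with \<open>S Z = A\<close> satisfies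
  \<open>A Z = - A\<close>, and the parallel sum is \<open>A - A Z = 2 A\<close>.

  Comparing operator norms in \<open>A C = c A\<close> gives \<open>\<bar>c\<bar> \<parallel>A\<parallel> \<le> \<parallel>A\<parallel> \<parallel>C\<parallel>\<close>, so \<open>\<parallel>C\<parallel> \<ge> \<bar>c\<bar>\<close> as soon as
  \<open>A \<noteq> 0\<close> (lemma \<open>onorm_ge_if_compose_eq_scaleR\<close>). The operators \<open>X\<^sub>1\<close> and \<open>A\<^sup>\<dagger>(A : B)\<close> satisfy
  \<open>A C = 2 A\<close>, while \<open>X\<^sub>2\<close> and \<open>S\<^sup>\<dagger> A\<close> satisfy \<open>S C = A\<close> and therefore \<open>A C = - A\<close>. This yields the
  lower bounds 2 and 1, which exceed \<open>\<surd>2\<close> and \<open>\<surd>2 - 1\<close>.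

  The rest of the work shows that the objects in this argument exist: adjoints (the Riesz
  representation theorem), the operator \<open>Z\<close> in the parallel sum (Douglas' theorem,
  \<open>reduced_solution_exists\<close>), and the Moore--Penrose inverse of an operator with closed range
  (\<open>mp_inverse\<close>), which is the Douglas solution of \<open>A X = P\<close> for the orthogonal projection \<open>P\<close>
  onto \<open>\<R>(A)\<close>. The analytic core is the boundedness in Douglas' theorem, which rests on the Baire
  category theorem.
\<close>

section \<open>Geometry of Hilbert spaces\<close>

lemma conj_zero: "conj (0::'k::real_or_complex) = 0"
  using conj_add[of "0::'k" 0] by simp

lemma conj_minus: "conj (- x) = - conj (x::'k::real_or_complex)"
  using conj_add[of x "- x"] by (simp add: conj_zero eq_neg_iff_add_eq_0 add.commute)

lemma norm_conj: "norm (conj x) = norm (x::'k::real_or_complex)"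
proof (cases "x = 0")
  case False
  have "norm x * norm (conj x) = (norm x)\<^sup>2"
    using arg_cong[OF mult_conj_self[of x], of norm] by (simp add: norm_mult)
  with False show ?thesis by (simp add: power2_eq_square)
qed (simp add: conj_zero)

lemma conj_conj: "conj (conj x) = (x::'k::real_or_complex)"
proof (cases "x = 0")
  case False
  have "conj x * conj (conj x) = conj x * x"
    using mult_conj_self[of x] mult_conj_self[of "conj x"] by (simp add: norm_conj mult.commute)
  moreover have "conj x \<noteq> 0"
    using False norm_conj[of x] by auto
  ultimately show ?thesis by simp
qed (simp add: conj_zero)

context hilbert_space
begin

lemma ip_zero_left [simp]: "ip 0 y = 0"
  using ip_add_left[of 0 0 y] by simp

lemma ip_minus_left: "ip (- x) y = - ip x y"
  using ip_add_left[of x "- x" y] by (simp add: eq_neg_iff_add_eq_0 add.commute)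

lemma ip_diff_left: "ip (x - y) z = ip x z - ip y z"
  using ip_add_left[of x "- y" z] by (simp add: ip_minus_left)

lemma ip_zero_right [simp]: "ip x 0 = 0"
  by (simp add: ip_conj[of x] conj_zero)

lemma ip_add_right: "ip x (y + z) = ip x y + ip x z"
  by (simp add: ip_conj[of x] ip_add_left conj_add)

lemma ip_minus_right: "ip x (- y) = - ip x y"
  by (simp add: ip_conj[of x] ip_minus_left conj_minus)

lemma ip_diff_right: "ip x (y - z) = ip x y - ip x z"
  using ip_add_right[of x y "- z"] by (simp add: ip_minus_right)

lemma ip_scale_right: "ip x (scale c y) = conj c * ip x y"
  by (simp add: ip_conj[of x] ip_scale_left conj_mult)

lemma ip_swap_eq_zero: "ip x y = 0 \<longleftrightarrow> ip y x = 0"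
  by (metis ip_conj conj_zero)

lemma ip_self_eq_zero [simp]: "ip x x = 0 \<longleftrightarrow> x = 0"
  by (simp add: ip_self)

lemma ip_right_eqI: "(\<And>x. ip x y = ip x z) \<Longrightarrow> y = z"
  by (metis ip_diff_right ip_self_eq_zero right_minus_eq)

lemma ip_left_eqI: "(\<And>x. ip y x = ip z x) \<Longrightarrow> y = z"
  by (metis ip_diff_left ip_self_eq_zero right_minus_eq)

lemma scaleR_eq_scale: "r *\<^sub>R x = scale (of_real r) x"
  by (simp add: scale_of_real)

lemma norm_scale: "norm (scale c x) = norm c * norm x"
proof -
  have "(of_real ((norm (scale c x))\<^sup>2) :: 'k) = c * conj c * ip x x"
    unfolding ip_self[symmetric] by (simp add: ip_scale_left ip_scale_right mult_ac)
  also have "\<dots> = of_real ((norm c * norm x)\<^sup>2)"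
    by (simp add: mult_conj_self ip_self power_mult_distrib scaleR_conv_of_real)
  finally show ?thesis
    by (simp only: of_real_eq_iff power2_eq_iff_nonneg norm_ge_zero mult_nonneg_nonneg)
qed

lemma pythagoras:
  assumes "ip x y = 0"
  shows "(norm (x + y))\<^sup>2 = (norm x)\<^sup>2 + (norm y)\<^sup>2"
proof -
  have "(of_real ((norm (x + y))\<^sup>2) :: 'k) = of_real ((norm x)\<^sup>2 + (norm y)\<^sup>2)"
    using assms ip_swap_eq_zero[of x y] unfolding of_real_add ip_self[symmetric]
    by (simp add: ip_add_left ip_add_right)
  then show ?thesis by (simp only: of_real_eq_iff)
qed

lemma parallelogram:
  fixes x y :: 'a
  shows "(norm (x + y))\<^sup>2 + (norm (x - y))\<^sup>2 = 2 * (norm x)\<^sup>2 + 2 * (norm y)\<^sup>2"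
proof -
  have "ip (x + y) (x + y) + ip (x - y) (x - y) = ip x x + ip x x + (ip y y + ip y y)"
    by (simp add: ip_add_left ip_add_right ip_diff_left ip_diff_right)
  then have "(of_real ((norm (x + y))\<^sup>2 + (norm (x - y))\<^sup>2) :: 'k)
      = of_real ((norm x)\<^sup>2 + (norm x)\<^sup>2 + ((norm y)\<^sup>2 + (norm y)\<^sup>2))"
    by (simp only: ip_self of_real_add)
  then show ?thesis by (simp only: of_real_eq_iff)
qed

text \<open>
  Subtracting the component along \<open>y\<close> leaves a vector orthogonal to \<open>y\<close>. The identity gives both the
  Cauchy--Schwarz inequality and the orthogonality of the error of a best approximation.
\<close>

lemma component_decomposition:
  fixes x y
  defines "c \<equiv> ip x y / ip y y"
  shows "(norm x)\<^sup>2 = (norm (x - scale c y))\<^sup>2 + (norm (scale c y))\<^sup>2"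
proof -
  have "ip (x - scale c y) y = 0"
    by (cases "y = 0") (simp_all add: c_def ip_diff_left ip_scale_left)
  then have "ip (x - scale c y) (scale c y) = 0"
    by (simp add: ip_scale_right)
  from pythagoras[OF this] show ?thesis by simp
qed

lemma cauchy_schwarz: "norm (ip x y) \<le> norm x * norm y"
proof (cases "y = 0")
  case False
  let ?c = "ip x y / ip y y"
  have "(norm (scale ?c y))\<^sup>2 \<le> (norm x)\<^sup>2"
    using component_decomposition[of x y] by simp
  then have "norm (scale ?c y) \<le> norm x"
    by (simp add: power2_le_iff_abs_le)
  moreover have "norm (scale ?c y) = norm (ip x y) / norm y"
    using False by (simp add: norm_scale norm_divide ip_self power2_eq_square norm_mult)
  ultimately show ?thesis
    using False by (simp add: field_simps)
qed simp

lemma bounded_linear_ip_left: "bounded_linear (\<lambda>x. ip x y)"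
  by (rule bounded_linear_intro[where K = "norm y"])
    (simp_all add: ip_add_left scaleR_eq_scale ip_scale_left cauchy_schwarz scaleR_conv_of_real)

lemma bounded_linear_scale: "bounded_linear (scale c)"
  by (rule bounded_linear_intro[where K = "norm c"])
    (simp_all add: scale_right_distrib scaleR_eq_scale norm_scale mult.commute)

lemma closed_orth: "closed (orth ip S)"
proof -
  have "orth ip S = (\<Inter>y\<in>S. {x. ip x y = 0})"
    by (auto simp: orth_def)
  moreover have "closed {x. ip x y = 0}" for y
    by (intro closed_Collect_eq continuous_intros
        bounded_linear.continuous_on[OF bounded_linear_ip_left])
  ultimately show ?thesis by (simp add: closed_INT)
qed

lemma subspace_orth: "subspace (orth ip S)"
  by (auto simp: subspace_def orth_def ip_add_left ip_scale_left)

lemma orth_inter_zero: "x \<in> S \<Longrightarrow> x \<in> orth ip S \<Longrightarrow> x = 0"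
  by (auto simp: orth_def)

lemma subspace_closure:
  assumes "subspace M"
  shows "subspace (closure M)"
proof (rule subspaceI)
  show "0 \<in> closure M"
    using assms closure_subset subspace_0 by blast
next
  fix x y assume "x \<in> closure M" "y \<in> closure M"
  then obtain f g where fg: "\<And>n. f n \<in> M" "f \<longlonglongrightarrow> x" "\<And>n. g n \<in> M" "g \<longlonglongrightarrow> y"
    unfolding closure_sequential by blast
  have "(\<lambda>n. f n + g n) \<longlonglongrightarrow> x + y"
    by (intro tendsto_add fg)
  moreover have "f n + g n \<in> M" for n
    using assms fg subspace_add by blast
  ultimately show "x + y \<in> closure M"
    unfolding closure_sequential by (intro exI[of _ "\<lambda>n. f n + g n"]) blast
next
  fix c x assume "x \<in> closure M"
  moreover have "scale c ` closure M \<subseteq> closure (scale c ` M)"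
    by (rule closure_bounded_linear_image_subset[OF bounded_linear_scale])
  moreover have "scale c ` M \<subseteq> M"
    using assms subspace_scale by blast
  ultimately show "scale c x \<in> closure M"
    using closure_mono by blast
qed

text \<open>
  By the parallelogram law a minimising sequence for the distance to a convex set is Cauchy: the
  midpoint of two near-minimisers is itself at least at the infimal distance, which forces them
  together.
\<close>

lemma nearest_point_exists:
  assumes M: "subspace M" "closed M"
  obtains m where "m \<in> M" "\<And>y. y \<in> M \<Longrightarrow> norm (x - m) \<le> norm (x - y)"
proof -
  define d where "d = (INF m\<in>M. (norm (x - m))\<^sup>2)"
  have ne: "M \<noteq> {}" using M subspace_0 by blast
  have bdd: "bdd_below ((\<lambda>m. (norm (x - m))\<^sup>2) ` M)"
    by (rule bdd_belowI[of _ 0]) auto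
  have low: "d \<le> (norm (x - m))\<^sup>2" if "m \<in> M" for m
    unfolding d_def by (rule cINF_lower[OF bdd that])
  have "\<exists>m\<in>M. (norm (x - m))\<^sup>2 < d + 1 / real (Suc n)" for n
  proof -
    have "(INF m\<in>M. (norm (x - m))\<^sup>2) < d + 1 / real (Suc n)"
      by (simp add: d_def)
    then show ?thesis
      using cINF_less_iff[OF ne bdd] by blast
  qed
  then obtain f where f: "\<And>n. f n \<in> M" "\<And>n. (norm (x - f n))\<^sup>2 < d + 1 / real (Suc n)"
    by metis
  have dist: "(norm (f i - f j))\<^sup>2 \<le> 2 / real (Suc i) + 2 / real (Suc j)" for i j
  proof -
    \<comment> \<open>Their difference is measured through the midpoint, whose squared distance is at least \<open>d\<close>.\<close>
    let ?m = "(1/2) *\<^sub>R (f i + f j)"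
    have "?m \<in> M"
      unfolding scaleR_eq_scale by (intro subspace_scale subspace_add M f)
    then have "d \<le> (norm (x - ?m))\<^sup>2" by (rule low)
    moreover have "(x - f j) + (x - f i) = 2 *\<^sub>R (x - ?m)"
      by (simp add: algebra_simps scaleR_2)
    then have "(norm ((x - f j) + (x - f i)))\<^sup>2 = 4 * (norm (x - ?m))\<^sup>2"
      by (simp add: power_mult_distrib)
    moreover have "(x - f j) - (x - f i) = f i - f j" by simp
    ultimately show ?thesis
      using parallelogram[of "x - f j" "x - f i"] f(2)[of i] f(2)[of j] by simp
  qed
  have "Cauchy f"
  proof (rule metric_CauchyI)
    fix e :: real assume "0 < e"
    then obtain N where N: "inverse (real (Suc N)) < e\<^sup>2 / 4"
      using reals_Archimedean[of "e\<^sup>2 / 4"] by auto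
    have "dist (f i) (f j) < e" if "N \<le> i" "N \<le> j" for i j
    proof -
      have "1 / real (Suc i) \<le> 1 / real (Suc N)" "1 / real (Suc j) \<le> 1 / real (Suc N)"
        using that by (simp_all add: frac_le)
      then have "(norm (f i - f j))\<^sup>2 < e\<^sup>2"
        using dist[of i j] N by (simp add: inverse_eq_divide)
      then show ?thesis
        using \<open>0 < e\<close> by (simp add: dist_norm power2_less_imp_less)
    qed
    then show "\<exists>N. \<forall>i\<ge>N. \<forall>j\<ge>N. dist (f i) (f j) < e" by blast
  qed
  then obtain m where m: "f \<longlonglongrightarrow> m"
    using Cauchy_convergent convergent_def by blast
  have "m \<in> M"
    using closed_sequentially[OF M(2) f(1) m] .
  moreover have "(norm (x - m))\<^sup>2 \<le> d + 0"
  proof (rule LIMSEQ_le)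
    show "(\<lambda>n. (norm (x - f n))\<^sup>2) \<longlonglongrightarrow> (norm (x - m))\<^sup>2"
      by (intro tendsto_intros m)
    show "(\<lambda>n. d + 1 / real (Suc n)) \<longlonglongrightarrow> d + 0"
      using LIMSEQ_inverse_real_of_nat by (intro tendsto_intros) (simp add: inverse_eq_divide)
    show "\<exists>N. \<forall>n\<ge>N. (norm (x - f n))\<^sup>2 \<le> d + 1 / real (Suc n)"
      using f(2) less_imp_le by blast
  qed
  then have "(norm (x - m))\<^sup>2 \<le> (norm (x - y))\<^sup>2" if "y \<in> M" for y
    using low[OF that] by linarith
  then have "norm (x - m) \<le> norm (x - y)" if "y \<in> M" for y
    using that power2_le_imp_le norm_ge_zero by blast
  ultimately show ?thesis by (rule that)
qed

lemma orth_proj_eqI: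
  assumes "subspace M" "m \<in> M" "x - m \<in> orth ip M"
  shows "orth_proj ip M x = m"
  unfolding orth_proj_def
proof (rule the_equality)
  fix m' assume m': "m' \<in> M \<and> x - m' \<in> orth ip M"
  then have "m' - m \<in> M"
    using assms subspace_diff by blast
  moreover have "m' - m = (x - m) - (x - m')" by simp
  then have "m' - m \<in> orth ip M"
    using assms m' subspace_diff[OF subspace_orth] by metis
  ultimately show "m' = m"
    using orth_inter_zero by fastforce
qed (use assms in blast)

text \<open>
  A best approximation \<open>m\<close> of \<open>x\<close> has an orthogonal error, since otherwise moving \<open>m\<close> along a
  vector \<open>y \<in> M\<close> not orthogonal to \<open>x - m\<close> would bring it closer.
\<close>

lemma orth_proj:
  assumes "subspace M" "closed M"
  shows "orth_proj ip M x \<in> M" and "x - orth_proj ip M x \<in> orth ip M"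
proof -
  obtain m where m: "m \<in> M" "\<And>y. y \<in> M \<Longrightarrow> norm (x - m) \<le> norm (x - y)"
    using nearest_point_exists[OF assms] by blast
  have "ip (x - m) y = 0" if "y \<in> M" for y
  proof -
    let ?c = "ip (x - m) y / ip y y"
    have "m + scale ?c y \<in> M"
      using assms that m subspace_add subspace_scale by blast
    from m(2)[OF this] have "norm (x - m) \<le> norm (x - m - scale ?c y)"
      by (simp add: algebra_simps)
    then have "(norm (x - m))\<^sup>2 \<le> (norm (x - m - scale ?c y))\<^sup>2"
      by (simp add: power_mono)
    then have "scale ?c y = 0"
      using component_decomposition[of "x - m" y] by simp
    then show ?thesis
      by (auto simp: scale_eq_0_iff)
  qed
  then have "x - m \<in> orth ip M"
    by (simp add: orth_def)
  with m orth_proj_eqI[OF assms(1)] show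
    "orth_proj ip M x \<in> M" "x - orth_proj ip M x \<in> orth ip M" by metis+
qed

text \<open>
  The null space of a nonzero functional \<open>f\<close> has a vector \<open>z\<close> with \<open>f z \<noteq> 0\<close> in its orthogonal
  complement, and every \<open>x\<close> differs from a multiple of \<open>z\<close> by an element of the null space. So
  \<open>f\<close> is represented by a multiple of \<open>z\<close>.
\<close>

lemma riesz:
  assumes f: "Vector_Spaces.linear scale (*) f" "bounded_linear f"
  shows "\<exists>w. \<forall>x. f x = ip x w"
proof (cases "\<forall>x. f x = 0")
  case True
  then show ?thesis by (intro exI[of _ 0]) simp
next
  case False
  interpret f: Vector_Spaces.linear scale "(*)" f by (rule f)
  let ?N = "{x. f x = 0}"
  have N: "subspace ?N"
    by (auto simp: subspace_def f.add f.scale)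
  have "closed ?N"
    by (intro closed_Collect_eq continuous_intros bounded_linear.continuous_on[OF f(2)])
  from False obtain u where u: "f u \<noteq> 0" by blast
  define z where "z = u - orth_proj ip ?N u"
  have z: "z \<in> orth ip ?N" "f (orth_proj ip ?N u) = 0"
    using orth_proj[OF N \<open>closed ?N\<close>, of u] by (auto simp: z_def)
  then have fz: "f z \<noteq> 0"
    using u by (simp add: z_def f.diff)
  then have "z \<noteq> 0" using f.zero by blast
  have "f x = ip x (scale (conj (f z / ip z z)) z)" for x
  proof -
    have "f (x - scale (f x / f z) z) = 0"
      using fz by (simp add: f.diff f.scale)
    then have "ip z (x - scale (f x / f z) z) = 0"
      using z by (simp add: orth_def)
    then have "ip (x - scale (f x / f z) z) z = 0"
      by (simp add: ip_swap_eq_zero[of z])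
    then have "ip x z = f x / f z * ip z z"
      by (simp add: ip_diff_left ip_scale_left)
    then show ?thesis
      using fz \<open>z \<noteq> 0\<close> by (simp add: ip_scale_right conj_conj)
  qed
  then show ?thesis by blast
qed

end

section \<open>Adjoints and bounded operators\<close>

lemma bounded_opD:
  assumes "bounded_op s t A"
  shows "A (x + y) = A x + A y" "A (s c x) = t c (A x)" "bounded_linear A"
    "A 0 = 0" "A (x - y) = A x - A y"
proof -
  from assms have lin: "Vector_Spaces.linear s t A" and bl: "bounded_linear A"
    by (simp_all add: bounded_op_def)
  show "A (x + y) = A x + A y" "A (s c x) = t c (A x)"
    using lin unfolding Vector_Spaces.linear_iff by blast+
  show "bounded_linear A" "A 0 = 0" "A (x - y) = A x - A y"
    using bl linear_simps(2,3)[OF bl] by blast+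
qed

lemma bounded_op_compose:
  assumes "bounded_op s t C" "bounded_op t u A"
  shows "bounded_op s u (A \<circ> C)"
proof -
  have "bounded_linear (A \<circ> C)"
    unfolding comp_def by (rule bounded_linear_compose; use assms in \<open>simp add: bounded_op_def\<close>)
  with assms show ?thesis
    unfolding bounded_op_def Vector_Spaces.linear_iff by (simp add: comp_def)
qed

lemma bounded_op_add:
  assumes "hilbert_space t h" "bounded_op s t A" "bounded_op s t B"
  shows "bounded_op s t (\<lambda>x. A x + B x)"
proof -
  interpret hilbert_space t h by fact
  have "bounded_linear (\<lambda>x. A x + B x)"
    by (rule bounded_linear_add; use assms in \<open>simp add: bounded_op_def\<close>)
  with assms(2,3) show ?thesis
    unfolding bounded_op_def Vector_Spaces.linear_iff by (simp add: scale_right_distrib)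
qed

lemma bounded_opI:
  assumes "hilbert_space s g" "hilbert_space t h"
    and add: "\<And>x y. A (x + y) = A x + A y" and scale: "\<And>c x. A (s c x) = t c (A x)"
    and bound: "\<And>x. norm (A x) \<le> K * norm x"
  shows "bounded_op s t A"
proof -
  interpret H: hilbert_space s g by fact
  interpret K: hilbert_space t h by fact
  have "bounded_linear A"
    by (rule bounded_linear_intro[where K = K])
      (use bound in \<open>simp_all add: add H.scaleR_eq_scale K.scaleR_eq_scale scale mult.commute\<close>)
  then show ?thesis
    by (auto simp: bounded_op_def Vector_Spaces.linear_iff add scale
        H.vector_space_axioms K.vector_space_axioms)
qed

lemma adjoint_exists:
  assumes "hilbert_space s g" "hilbert_space t h" and A: "bounded_op s t A"
  shows "\<exists>A'. \<forall>x y. h (A x) y = g x (A' y)"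
proof -
  interpret H: hilbert_space s g by fact
  interpret K: hilbert_space t h by fact
  have "\<exists>w. \<forall>x. h (A x) y = g x w" for y
  proof (rule H.riesz)
    show "Vector_Spaces.linear s (*) (\<lambda>x. h (A x) y)"
      using H.vector_space_axioms
      by (auto simp: Vector_Spaces.linear_iff bounded_opD(1,2)[OF A] K.ip_add_left K.ip_scale_left
          vector_space_def algebra_simps)
    show "bounded_linear (\<lambda>x. h (A x) y)"
      by (rule bounded_linear_compose[OF K.bounded_linear_ip_left bounded_opD(3)[OF A]])
  qed
  then show ?thesis by metis
qed

lemma adj_eqI:
  assumes "hilbert_space s g" "\<And>x y. h (A x) y = g x (A' y)"
  shows "adj g h A = A'"
proof -
  interpret H: hilbert_space s g by fact
  show ?thesis
    unfolding adj_def
  proof (rule the_equality)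
    fix A'' assume *: "\<forall>x y. h (A x) y = g x (A'' y)"
    show "A'' = A'"
    proof
      fix y show "A'' y = A' y"
        by (rule H.ip_right_eqI) (simp add: *[rule_format, symmetric] assms(2))
    qed
  qed (use assms in blast)
qed

lemma adj:
  assumes "hilbert_space s g" "hilbert_space t h" "bounded_op s t A"
  shows "h (A x) y = g x (adj g h A y)"
proof -
  obtain A' where A': "\<And>x y. h (A x) y = g x (A' y)"
    using adjoint_exists[OF assms] by blast
  with adj_eqI[OF assms(1), of h A A'] show ?thesis by simp
qed

lemma subspace_range_adj:
  assumes "hilbert_space s g" "hilbert_space t h" and A: "bounded_op s t A"
  shows "module.subspace s (range (adj g h A))"
proof -
  interpret H: hilbert_space s g by fact
  interpret K: hilbert_space t h by fact
  note adj = adj[OF assms, symmetric]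
  have "0 = adj g h A 0"
    by (rule H.ip_right_eqI) (simp add: adj)
  moreover have "adj g h A x + adj g h A y = adj g h A (x + y)" for x y
    by (rule H.ip_right_eqI) (simp add: adj H.ip_add_right K.ip_add_right)
  moreover have "s c (adj g h A x) = adj g h A (t c x)" for c x
    by (rule H.ip_right_eqI) (simp add: adj H.ip_scale_right K.ip_scale_right)
  ultimately show ?thesis
    by (intro H.subspaceI) (force simp: image_iff)+
qed

lemma closed_null_space:
  assumes "bounded_op s t A"
  shows "closed (null_space A)"
  unfolding null_space_def
  by (intro closed_Collect_eq continuous_intros
      bounded_linear.continuous_on[OF bounded_opD(3)[OF assms]])

lemma subspace_null_space:
  assumes "hilbert_space s g" "hilbert_space t h" and A: "bounded_op s t A"
  shows "module.subspace s (null_space A)"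
proof -
  interpret H: hilbert_space s g by fact
  interpret K: hilbert_space t h by fact
  show ?thesis
    by (auto simp: H.subspace_def null_space_def bounded_opD[OF A])
qed

lemma subspace_range:
  assumes "hilbert_space s g" "hilbert_space t h" and A: "bounded_op s t A"
  shows "module.subspace t (range A)"
proof -
  interpret K: hilbert_space t h by fact
  show ?thesis
    by (intro K.subspaceI)
      (auto simp: image_iff bounded_opD(1,2,4)[OF A, symmetric])
qed

text \<open>
  The part of \<open>z \<in> \<N>(A)\<^sup>\<bottom>\<close> that is orthogonal to the closure of \<open>\<R>(A\<^sup>*)\<close> lies in \<open>\<N>(A)\<close>, and it
  also lies in \<open>\<N>(A)\<^sup>\<bottom>\<close>, because the closure is contained there. It is therefore zero.
\<close>

lemma orth_null_space_subset_closure_range_adj: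
  assumes "hilbert_space s g" "hilbert_space t h" and A: "bounded_op s t A"
  shows "orth g (null_space A) \<subseteq> closure (range (adj g h A))"
proof
  interpret H: hilbert_space s g by fact
  interpret K: hilbert_space t h by fact
  let ?R = "closure (range (adj g h A))"
  fix z assume z: "z \<in> orth g (null_space A)"
  note R = H.subspace_closure[OF subspace_range_adj[OF assms]]
  define p where "p = orth_proj g ?R z"
  have p: "p \<in> ?R" "z - p \<in> orth g ?R"
    using H.orth_proj[OF R closed_closure] by (simp_all add: p_def)
  have "h (A (z - p)) w = h 0 w" for w
    using p(2) closure_subset[of "range (adj g h A)"] by (auto simp: adj[OF assms] orth_def)
  then have null: "z - p \<in> null_space A"
    using K.ip_left_eqI[of "A (z - p)" 0] by (simp add: null_space_def)
  have "range (adj g h A) \<subseteq> orth g (null_space A)"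
  proof (clarsimp simp: orth_def null_space_def)
    fix w y assume "A y = 0"
    then have "g y (adj g h A w) = 0" by (simp add: adj[OF assms, symmetric])
    then show "g (adj g h A w) y = 0" by (simp add: H.ip_swap_eq_zero[of y])
  qed
  then have "p \<in> orth g (null_space A)"
    using p(1) closure_minimal[OF _ H.closed_orth] by blast
  then have "z - p \<in> orth g (null_space A)"
    using z H.subspace_diff[OF H.subspace_orth] by blast
  with null have "z - p = 0"
    by (rule H.orth_inter_zero)
  with p(1) show "z \<in> ?R" by simp
qed

section \<open>Douglas reduced solutions\<close>

lemma reduced_solutionD:
  assumes "reduced_solution s t g A B C"
  shows "bounded_op s t C" "B (C x) = A x" "C x \<in> orth g (null_space B)"
  using assms by (auto simp: reduced_solution_def)

text \<open>
  Range inclusion implies the majorization that makes the Douglas solution bounded. The sets \<open>F n\<close>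
  of those \<open>x\<close> that satisfy the inequality with constant \<open>n\<close> in place of \<open>K \<parallel>x\<parallel>\<close> are closed, and
  they cover the space: if \<open>A x = S y\<close>, then \<open>\<langle>A x, w\<rangle> = \<langle>y, S\<^sup>* w\<rangle>\<close>, so every \<open>n \<ge> \<parallel>y\<parallel>\<close> works for
  \<open>x\<close>. By Baire's theorem some \<open>F n\<close> contains a ball, and linearity spreads the bound to all \<open>x\<close>.
\<close>

lemma douglas_majorization:
  assumes "hilbert_space s g" "hilbert_space t h" "hilbert_space u k"
    and A: "bounded_op s t A" and S: "bounded_op u t S" and sub: "range A \<subseteq> range S"
  obtains K where "0 \<le> K" "\<And>x w. norm (h (A x) w) \<le> K * norm x * norm (adj k h S w)"
proof -
  interpret K: hilbert_space t h by fact
  interpret L: hilbert_space u k by fact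
  define F where "F n = {x. \<forall>w. norm (h (A x) w) \<le> real n * norm (adj k h S w)}" for n :: nat
  have bl: "bounded_linear (\<lambda>x. h (A x) w)" for w
    by (rule bounded_linear_compose[OF K.bounded_linear_ip_left bounded_opD(3)[OF A]])
  have clF: "closed (F n)" for n
    unfolding F_def
    by (intro closed_Collect_all closed_Collect_le continuous_intros
        bounded_linear.continuous_on[OF bl])
  have "x \<in> (\<Union>n. F n)" for x
  proof -
    obtain y where y: "A x = S y" using sub by blast
    obtain n where n: "norm y \<le> real n" using real_arch_simple by blast
    have "norm (h (A x) w) \<le> real n * norm (adj k h S w)" for w
    proof -
      have "norm (h (A x) w) \<le> norm y * norm (adj k h S w)"
        unfolding y adj[OF assms(3,2) S] by (rule L.cauchy_schwarz)
      also have "\<dots> \<le> real n * norm (adj k h S w)"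
        by (rule mult_right_mono[OF n norm_ge_zero])
      finally show ?thesis .
    qed
    then show ?thesis by (auto simp: F_def)
  qed
  then have cover: "(\<Union>n. F n) = UNIV" by blast
  have "\<exists>n. interior (F n) \<noteq> {}"
  proof (rule ccontr)
    assume "\<nexists>n. interior (F n) \<noteq> {}"
    then have "euclidean interior_of \<Union> (range F) = {}"
      by (intro Baire_category_alt)
        (auto simp: completely_metrizable_space_euclidean clF)
    then show False using cover by simp
  qed
  then obtain n x0 r where r: "0 < r" "ball x0 r \<subseteq> F n"
    by (meson ex_in_conv mem_interior)
  have small: "norm (h (A x) w) \<le> 2 * real n * norm (adj k h S w)" if "norm x < r" for x w
  proof -
    have "x0 \<in> F n" "x0 + x \<in> F n"
      using r that by (auto simp: subset_iff dist_norm)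
    then have "norm (h (A x0) w) \<le> real n * norm (adj k h S w)"
        "norm (h (A (x0 + x)) w) \<le> real n * norm (adj k h S w)"
      by (auto simp: F_def)
    moreover have "h (A x) w = h (A (x0 + x)) w - h (A x0) w"
      by (simp add: bounded_opD(1)[OF A] K.ip_add_left)
    ultimately show ?thesis
      using norm_triangle_ineq4[of "h (A (x0 + x)) w" "h (A x0) w"] by simp
  qed
  have "norm (h (A x) w) \<le> (4 * real n / r) * norm x * norm (adj k h S w)" for x w
  proof (cases "x = 0")
    case False
    \<comment> \<open>Scale \<open>x\<close> to norm \<open>r / 2\<close>, inside the ball.\<close>
    let ?c = "r / (2 * norm x)"
    have "norm (?c *\<^sub>R x) < r" using False r by simp
    from small[OF this, of w]
    have "\<bar>?c\<bar> * norm (h (A x) w) \<le> 2 * real n * norm (adj k h S w)"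
      using linear_simps(5)[OF bl, of ?c x w] by simp
    then show ?thesis
      using False r by (simp add: field_simps)
  qed (use bounded_opD(4)[OF A] in simp)
  moreover have "0 \<le> 4 * real n / r" using r by simp
  ultimately show ?thesis by (intro that)
qed

text \<open>
  Douglas' theorem. The solution \<open>Z x\<close> is the component in \<open>\<N>(S)\<^sup>\<bottom>\<close> of any preimage of \<open>A x\<close> under
  \<open>S\<close>; its uniqueness gives linearity. For boundedness, the majorization reads
  \<open>\<bar>\<langle>Z x, v\<rangle>\<bar> \<le> K \<parallel>x\<parallel> \<parallel>v\<parallel>\<close> for \<open>v\<close> in \<open>\<R>(S\<^sup>*)\<close>. This extends to the closure, which contains \<open>Z x\<close>,
  so that \<open>v = Z x\<close> is allowed.
\<close>

lemma reduced_solution_exists: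
  assumes "hilbert_space s g" "hilbert_space t h" "hilbert_space u k"
    and A: "bounded_op s t A" and S: "bounded_op u t S" and sub: "range A \<subseteq> range S"
  shows "\<exists>Z. reduced_solution s u k A S Z"
proof -
  interpret L: hilbert_space u k by fact
  let ?N = "null_space S"
  note N = subspace_null_space[OF assms(3,2) S] closed_null_space[OF S]
  have "\<exists>z. z \<in> orth k ?N \<and> S z = A x" for x
  proof -
    obtain y where y: "A x = S y" using sub by blast
    have "S (y - orth_proj k ?N y) = S y"
      using L.orth_proj(1)[OF N, of y] by (simp add: bounded_opD(5)[OF S] null_space_def)
    then show ?thesis
      using L.orth_proj(2)[OF N] y by metis
  qed
  then obtain Z where Z: "\<And>x. Z x \<in> orth k ?N" "\<And>x. S (Z x) = A x" by metis
  have Z_eqI: "Z x = z" if "z \<in> orth k ?N" "S z = A x" for x z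
  proof -
    have "Z x - z \<in> orth k ?N"
      using Z that L.subspace_diff[OF L.subspace_orth] by blast
    moreover have "Z x - z \<in> ?N"
      using that by (simp add: null_space_def bounded_opD(5)[OF S] Z)
    ultimately show ?thesis
      using L.orth_inter_zero by fastforce
  qed
  have add: "Z (x + y) = Z x + Z y" for x y
    by (rule Z_eqI) (auto intro: L.subspace_add L.subspace_orth simp: Z bounded_opD(1)[OF A] bounded_opD(1)[OF S])
  have scale: "Z (s c x) = u c (Z x)" for c x
    by (rule Z_eqI) (auto intro: L.subspace_scale L.subspace_orth simp: Z bounded_opD(2)[OF A] bounded_opD(2)[OF S])
  obtain K where "0 \<le> K" and K: "\<And>x w. norm (h (A x) w) \<le> K * norm x * norm (adj k h S w)"
    using douglas_majorization[OF assms] by blast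
  have "norm (Z x) \<le> K * norm x" for x
  proof -
    let ?G = "{v. norm (k v (Z x)) \<le> K * norm x * norm v}"
    have "closed ?G"
      by (intro closed_Collect_le continuous_intros
          bounded_linear.continuous_on[OF L.bounded_linear_ip_left])
    moreover have "range (adj k h S) \<subseteq> ?G"
    proof clarify
      fix w
      have "k (Z x) (adj k h S w) = h (A x) w"
        by (simp add: adj[OF assms(3,2) S, symmetric] Z)
      then show "norm (k (adj k h S w) (Z x)) \<le> K * norm x * norm (adj k h S w)"
        using K[of x w] by (metis L.ip_conj norm_conj)
    qed
    ultimately have "closure (range (adj k h S)) \<subseteq> ?G"
      by (simp add: closure_minimal)
    then have "Z x \<in> ?G"
      using Z(1) orth_null_space_subset_closure_range_adj[OF assms(3,2) S] by blast
    then have "norm (Z x) * norm (Z x) \<le> K * norm x * norm (Z x)"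
      by (simp add: L.ip_self norm_mult power2_eq_square)
    then show ?thesis
      using \<open>0 \<le> K\<close> by (cases "Z x = 0") auto
  qed
  then have "bounded_op s u Z"
    by (intro bounded_opI[OF assms(1,3)] add scale)
  then have "reduced_solution s u k A S Z"
    using Z by (auto simp: reduced_solution_def fun_eq_iff)
  then show ?thesis by blast
qed

lemma reduced_solution_unique:
  assumes "hilbert_space u k" and S: "bounded_op u t S"
    and "reduced_solution s u k A S Z" "reduced_solution s u k A S Z'"
  shows "Z = Z'"
proof
  interpret L: hilbert_space u k by fact
  fix x
  have "Z x - Z' x \<in> orth k (null_space S)"
    using assms by (intro L.subspace_diff[OF L.subspace_orth] reduced_solutionD(3))
  moreover have "Z x - Z' x \<in> null_space S"
    by (simp add: null_space_def bounded_opD(5)[OF S] reduced_solutionD(2)[OF assms(3)]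
        reduced_solutionD(2)[OF assms(4)])
  ultimately show "Z x = Z' x"
    using L.orth_inter_zero by fastforce
qed

section \<open>The Moore--Penrose inverse\<close>

text \<open>
  If \<open>A X\<close> and \<open>A Y\<close> are self-adjoint, then taking adjoints in \<open>A X = (A Y)(A X)\<close> gives
  \<open>A X = (A X)(A Y) = A Y\<close>. Symmetrically \<open>X A = Y A\<close>, and so \<open>X = X A X = Y A Y = Y\<close>.
\<close>

lemma mp_inverse_unique:
  assumes "hilbert_space s g" "hilbert_space t h"
    and A: "bounded_op s t A" and XY: "bounded_op t s X" "bounded_op t s Y"
    and X: "A \<circ> X \<circ> A = A" "X \<circ> A \<circ> X = X"
      "adj h h (A \<circ> X) = A \<circ> X" "adj g g (X \<circ> A) = X \<circ> A"
    and Y: "A \<circ> Y \<circ> A = A" "Y \<circ> A \<circ> Y = Y"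
      "adj h h (A \<circ> Y) = A \<circ> Y" "adj g g (Y \<circ> A) = Y \<circ> A"
  shows "X = Y"
proof -
  interpret H: hilbert_space s g by fact
  interpret K: hilbert_space t h by fact
  have AX: "h (A (X u)) v = h u (A (X v))" and AY: "h (A (Y u)) v = h u (A (Y v))" for u v
    using adj[OF assms(2,2) bounded_op_compose[OF XY(1) A], of u v]
      adj[OF assms(2,2) bounded_op_compose[OF XY(2) A], of u v] X Y by simp_all
  have XA: "g (X (A u)) v = g u (X (A v))" and YA: "g (Y (A u)) v = g u (Y (A v))" for u v
    using adj[OF assms(1,1) bounded_op_compose[OF A XY(1)], of u v]
      adj[OF assms(1,1) bounded_op_compose[OF A XY(2)], of u v] X Y by simp_all
  have AXA: "A (X (A u)) = A u" "A (Y (A u)) = A u" and XAX: "X (A (X v)) = X v" "Y (A (Y v)) = Y v" for u v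
    using X Y by (metis comp_apply)+
  have 1: "A (X u) = A (Y u)" for u
    by (rule K.ip_left_eqI) (metis AX AY AXA)
  have 2: "X (A u) = Y (A u)" for u
    by (rule H.ip_left_eqI) (metis XA YA AXA)
  show ?thesis
    by (rule ext) (metis 1 2 XAX)
qed

text \<open>
  The Douglas reduced solution \<open>X\<close> of \<open>A X = P\<close>, with \<open>P\<close> the orthogonal projection onto the closed
  subspace \<open>\<R>(A)\<close>, satisfies the four Penrose equations: \<open>A X = P\<close> is self-adjoint and fixes \<open>\<R>(A)\<close>,
  and \<open>X A\<close> is the orthogonal projection onto \<open>\<N>(A)\<^sup>\<bottom>\<close>. Together with uniqueness this identifies
  the Moore--Penrose inverse.
\<close>

lemma mp_inverse:
  assumes "hilbert_space s g" "hilbert_space t h"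
    and A: "bounded_op s t A" and cl: "closed (range A)"
  shows "bounded_op t s (mp_inverse s g t h A)" and "A (mp_inverse s g t h A (A x)) = A x"
proof -
  interpret H: hilbert_space s g by fact
  interpret K: hilbert_space t h by fact
  let ?P = "orth_proj h (range A)" and ?M = "orth g (null_space A)"
  note R = subspace_range[OF assms(1-3)]
  have P_eq: "?P v = p" if "p \<in> range A" "v - p \<in> orth h (range A)" for v p
    by (rule K.orth_proj_eqI[OF R that])
  have P: "?P v \<in> range A" "v - ?P v \<in> orth h (range A)" for v
    using K.orth_proj[OF R cl] by blast+
  have P_self: "h (?P u) v = h u (?P v)" for u v
  proof -
    have "h (u - ?P u) (?P v) = 0"
      using P unfolding orth_def by blast
    moreover have "h (v - ?P v) (?P u) = 0"
      using P unfolding orth_def by blast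
    then have "h (?P u) (v - ?P v) = 0"
      by (simp add: K.ip_swap_eq_zero[of "?P u"])
    ultimately show ?thesis
      by (simp add: K.ip_diff_left K.ip_diff_right)
  qed
  have P_range: "?P (A x) = A x" for x
    by (rule P_eq) (simp_all add: orth_def)
  have P_bound: "norm (?P v) \<le> 1 * norm v" for v
  proof -
    have "h (v - ?P v) (?P v) = 0"
      using P unfolding orth_def by blast
    from K.pythagoras[OF this] have "(norm (?P v))\<^sup>2 \<le> (norm v)\<^sup>2" by simp
    then show ?thesis by (simp add: power2_le_iff_abs_le)
  qed
  have "bounded_op t t ?P"
  proof (rule bounded_opI[OF assms(2,2) _ _ P_bound])
    show "?P (x + y) = ?P x + ?P y" for x y
    proof (rule P_eq)
      have "x + y - (?P x + ?P y) = (x - ?P x) + (y - ?P y)" by simp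
      then show "x + y - (?P x + ?P y) \<in> orth h (range A)"
        using P K.subspace_add[OF K.subspace_orth] by metis
    qed (intro K.subspace_add[OF R] P)
    show "?P (t c x) = t c (?P x)" for c x
    proof (rule P_eq)
      have "t c x - t c (?P x) = t c (x - ?P x)" by (simp add: K.scale_right_diff_distrib)
      then show "t c x - t c (?P x) \<in> orth h (range A)"
        using P K.subspace_scale[OF K.subspace_orth] by metis
    qed (intro K.subspace_scale[OF R] P)
  qed
  then obtain X where X: "reduced_solution t s g ?P A X"
    using reduced_solution_exists[OF assms(2,2,1) _ A] P(1) by blast
  have bX: "bounded_op t s X" and AX: "A (X v) = ?P v" and XM: "X v \<in> ?M" for v
    by (fact reduced_solutionD[OF X])+
  have inj: "x = y" if "x \<in> ?M" "y \<in> ?M" "A x = A y" for x y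
  proof -
    have "x - y \<in> ?M" by (intro H.subspace_diff[OF H.subspace_orth] that)
    moreover have "x - y \<in> null_space A"
      using that by (simp add: null_space_def bounded_opD(5)[OF A])
    ultimately show ?thesis using H.orth_inter_zero by fastforce
  qed
  have XA_self: "g (X (A u)) v = g u (X (A v))" for u v
  proof -
    have null: "x - X (A x) \<in> null_space A" for x
      by (simp add: null_space_def bounded_opD(5)[OF A] AX P_range)
    have "g (X (A u)) (v - X (A v)) = 0" "g (X (A v)) (u - X (A u)) = 0"
      using null XM by (auto simp: orth_def)
    then have "g (X (A u)) (v - X (A v)) = 0" "g (u - X (A u)) (X (A v)) = 0"
      by (simp_all add: H.ip_swap_eq_zero[of "X (A v)"])
    then show ?thesis
      by (simp add: H.ip_diff_left H.ip_diff_right)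
  qed
  let ?pen = "\<lambda>X. bounded_op t s X \<and> A \<circ> X \<circ> A = A \<and> X \<circ> A \<circ> X = X \<and>
    adj h h (A \<circ> X) = A \<circ> X \<and> adj g g (X \<circ> A) = X \<circ> A"
  have pen: "?pen X"
  proof (intro conjI bX)
    show "A \<circ> X \<circ> A = A"
      by (simp add: fun_eq_iff AX P_range)
    \<comment> \<open>Both sides take values in \<open>\<N>(A)\<^sup>\<bottom>\<close>, where \<open>A\<close> is injective.\<close>
    show "X \<circ> A \<circ> X = X"
      by (rule ext) (auto intro!: inj simp: XM AX[of "A _"] P_range)
    show "adj h h (A \<circ> X) = A \<circ> X"
      by (rule adj_eqI[OF assms(2)]) (simp add: AX P_self)
    show "adj g g (X \<circ> A) = X \<circ> A"
      by (rule adj_eqI[OF assms(1)]) (simp add: XA_self)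
  qed
  moreover have "Y = X" if "?pen Y" for Y
    using mp_inverse_unique[OF assms(1-3), of Y X] that pen by blast
  ultimately have "?pen (mp_inverse s g t h A)"
    unfolding mp_inverse_def by (rule theI)
  then show "bounded_op t s (mp_inverse s g t h A)" "A (mp_inverse s g t h A (A x)) = A x"
    by (auto simp: fun_eq_iff)
qed

section \<open>Norm bounds for the parallel sum\<close>

text \<open>
  The projection onto the first summand is \<open>(x, y) \<mapsto> (x, 0)\<close>, so the lower blocks
  \<open>T\<^sub>2\<^sub>1\<close> and \<open>T\<^sub>2\<^sub>2\<close> in the definition of complementability are \<open>A\<close> and \<open>S\<close>.
\<close>

lemma range_subset_if_complementable:
  assumes "hilbert_space s g" "hilbert_space t h"
    and comp: "complementable (prod_ip g g) (prod_ip h h) (UNIV \<times> {0}) (UNIV \<times> {0})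
      (block_op A A A S)"
    and zero: "A 0 = 0" "S 0 = 0"
  shows "range A \<subseteq> range S"
proof -
  have proj: "orth_proj (prod_ip g' g') (UNIV \<times> {0}) = (\<lambda>v. (fst v, 0))"
    if "hilbert_space s' g'" for s' :: "'k::real_or_complex \<Rightarrow> 'x::banach \<Rightarrow> 'x" and g'
  proof
    interpret E: hilbert_space s' g' by fact
    interpret H: hilbert_space "prod_scale s' s'" "prod_ip g' g'"
      by (intro hilbert_space_prod that)
    fix v :: "'x \<times> 'x"
    show "orth_proj (prod_ip g' g') (UNIV \<times> {0}) v = (fst v, 0)"
      by (rule H.orth_proj_eqI)
        (auto simp: H.subspace_def prod_scale_def orth_def prod_ip_def zero_prod_def)
  qed
  have "range (\<lambda>v::'b \<times> 'b. (0::'c, A (fst v))) \<subseteq> range (\<lambda>v::'b \<times> 'b. (0::'c, S (snd v)))"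
    using comp zero unfolding complementable_def Let_def
    by (simp add: proj[OF assms(1)] proj[OF assms(2)] block_op_def comp_def split_beta)
  then have "(0, A x) \<in> range (\<lambda>v::'b \<times> 'b. (0::'c, S (snd v)))" for x
    by (metis (no_types, lifting) fst_conv rangeI subsetD)
  then show ?thesis by (auto simp: image_iff)
qed

lemma onorm_ge_if_compose_eq_scaleR:
  assumes A: "bounded_linear A" "A \<noteq> (\<lambda>x. 0)" and C: "bounded_linear C"
    and AC: "\<And>x. A (C x) = c *\<^sub>R A x"
  shows "\<bar>c\<bar> \<le> onorm C"
proof -
  have "\<bar>c\<bar> * onorm A = onorm (A \<circ> C)"
    by (simp add: comp_def AC onorm_scaleR[OF A(1)])
  also have "\<dots> \<le> onorm A * onorm C"
    by (rule onorm_compose[OF A(1) C])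
  finally have "onorm A * \<bar>c\<bar> \<le> onorm A * onorm C"
    by (simp add: mult.commute)
  moreover have "0 < onorm A"
    using A by (auto simp: onorm_pos_lt fun_eq_iff)
  ultimately show ?thesis
    by simp
qed

theorem proposition4p4:
  fixes s1 :: "'k::real_or_complex \<Rightarrow> 'a::banach \<Rightarrow> 'a" and ip1 :: "'a \<Rightarrow> 'a \<Rightarrow> 'k"
    and s2 :: "'k \<Rightarrow> 'b::banach \<Rightarrow> 'b" and ip2 :: "'b \<Rightarrow> 'b \<Rightarrow> 'k"
    and A B :: "'a \<Rightarrow> 'b"
  assumes "hilbert_space s1 ip1" and "hilbert_space s2 ip2"
    and "bounded_op s1 s2 A" and "bounded_op s1 s2 B"
    and "complementable (prod_ip ip1 ip1) (prod_ip ip2 ip2) (UNIV \<times> {0}) (UNIV \<times> {0})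
           (block_op A A A (\<lambda>x. A x + B x))"
    and "\<forall>x. adj ip1 ip2 A (2 *\<^sub>R A x + B x) = 0"
    and nonzero: "A \<noteq> (\<lambda>x. 0)"
  shows "(\<forall>X1. reduced_solution s1 s1 ip1 (parallel_sum s1 ip1 A B) A X1 \<longrightarrow> sqrt 2 \<le> onorm X1) \<and>
         (closed (range A) \<longrightarrow>
            sqrt 2 \<le> onorm (mp_inverse s1 ip1 s2 ip2 A \<circ> parallel_sum s1 ip1 A B)) \<and>
         (\<forall>X2. reduced_solution s1 s1 ip1 A (\<lambda>x. A x + B x) X2 \<longrightarrow> sqrt 2 - 1 \<le> onorm X2) \<and>
         (closed (range (\<lambda>x. A x + B x)) \<longrightarrow>
            sqrt 2 - 1 \<le> onorm (mp_inverse s1 ip1 s2 ip2 (\<lambda>x. A x + B x) \<circ> A))"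
proof -
  interpret H: hilbert_space s1 ip1 by fact
  interpret K: hilbert_space s2 ip2 by fact
  let ?S = "\<lambda>x. A x + B x"
  note A = \<open>bounded_op s1 s2 A\<close> and spaces = assms(1,2)
  note blA = bounded_opD(3)[OF A]
  have S: "bounded_op s1 s2 ?S"
    by (rule bounded_op_add[OF spaces(2) A assms(4)])
  have sub: "range A \<subseteq> range ?S"
    using range_subset_if_complementable[OF spaces assms(5)] bounded_opD(4)[OF A] bounded_opD(4)[OF S]
    by simp
  have orth: "ip2 (A u) (2 *\<^sub>R A x + B x) = 0" for u x
    by (simp add: adj[OF spaces A] assms(6))
  \<comment> \<open>The vector \<open>A (z + x)\<close> lies in \<open>\<R>(A)\<close> and in \<open>\<R>(2A + B)\<close>, hence is orthogonal to itself.\<close>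
  have A_minus: "A z = - A x" if "?S z = A x" for z x
  proof -
    have "2 *\<^sub>R A z + B z = A (z + x)"
      using that by (simp add: scaleR_2 bounded_opD(1)[OF A])
    then have "ip2 (A (z + x)) (A (z + x)) = 0"
      using orth by metis
    then show ?thesis
      by (simp add: bounded_opD(1)[OF A] eq_neg_iff_add_eq_0)
  qed
  obtain Z where Z: "reduced_solution s1 s1 ip1 A ?S Z"
    using reduced_solution_exists[OF spaces spaces(1) A S sub] by blast
  have the_Z: "(THE Z. reduced_solution s1 s1 ip1 A ?S Z) = Z"
  proof (rule the_equality)
    show "Z' = Z" if "reduced_solution s1 s1 ip1 A ?S Z'" for Z'
      by (rule reduced_solution_unique[OF spaces(1) S that Z])
  qed (rule Z)
  have AZ: "A (Z x) = - A x" for x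
    by (rule A_minus[OF reduced_solutionD(2)[OF Z]])
  have psum: "parallel_sum s1 ip1 A B = (\<lambda>x. 2 *\<^sub>R A x)"
    unfolding parallel_sum_def the_Z Let_def AZ by (simp add: scaleR_2)
  have sqrt2: "sqrt 2 \<le> 2" "sqrt 2 - 1 \<le> 1"
    using real_sqrt_le_mono[of 2 4] by simp_all
  have two: "sqrt 2 \<le> onorm X" if "bounded_linear X" "\<And>x. A (X x) = 2 *\<^sub>R A x" for X
    using onorm_ge_if_compose_eq_scaleR[OF blA nonzero that] sqrt2(1) by simp
  have one: "sqrt 2 - 1 \<le> onorm X" if "bounded_linear X" "\<And>x. ?S (X x) = A x" for X
  proof -
    have "A (X x) = (-1) *\<^sub>R A x" for x
      using A_minus[OF that(2)] by simp
    from onorm_ge_if_compose_eq_scaleR[OF blA nonzero that(1) this] sqrt2(2)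
    show ?thesis by simp
  qed
  show ?thesis
  proof (intro conjI allI impI)
    fix X assume "reduced_solution s1 s1 ip1 (parallel_sum s1 ip1 A B) A X"
    note X = reduced_solutionD[OF this]
    show "sqrt 2 \<le> onorm X"
      by (rule two[OF bounded_opD(3)[OF X(1)]]) (simp add: X(2) psum)
  next
    assume "closed (range A)"
    note mp = mp_inverse[OF spaces A this]
    show "sqrt 2 \<le> onorm (mp_inverse s1 ip1 s2 ip2 A \<circ> parallel_sum s1 ip1 A B)"
    proof (rule two)
      show "bounded_linear (mp_inverse s1 ip1 s2 ip2 A \<circ> parallel_sum s1 ip1 A B)"
        unfolding psum comp_def
        by (intro bounded_linear_compose[OF bounded_opD(3)[OF mp(1)]]
            bounded_linear_const_scaleR blA)
      show "A ((mp_inverse s1 ip1 s2 ip2 A \<circ> parallel_sum s1 ip1 A B) x) = 2 *\<^sub>R A x" for x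
        using mp(2)[of "2 *\<^sub>R x"] by (simp add: psum linear_simps(5)[OF blA])
    qed
  next
    fix X assume "reduced_solution s1 s1 ip1 A ?S X"
    note X = reduced_solutionD[OF this]
    show "sqrt 2 - 1 \<le> onorm X"
      by (rule one[OF bounded_opD(3)[OF X(1)] X(2)])
  next
    assume "closed (range ?S)"
    note mp = mp_inverse[OF spaces S this]
    show "sqrt 2 - 1 \<le> onorm (mp_inverse s1 ip1 s2 ip2 ?S \<circ> A)"
    proof (rule one)
      show "bounded_linear (mp_inverse s1 ip1 s2 ip2 ?S \<circ> A)"
        unfolding comp_def
        by (rule bounded_linear_compose[OF bounded_opD(3)[OF mp(1)] blA])
      fix x
      obtain y where "A x = ?S y" using sub by blast
      then show "?S ((mp_inverse s1 ip1 s2 ip2 ?S \<circ> A) x) = A x"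
        using mp(2)[of y] by simp
    qed
  qed
qed

end
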